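(* For all integers $\ell,m\ge0$, we have $$\sum_{j\ge0}(-1)^j\binom{\ell-j}{j}\,b_{\ell-j,m}=\binom{m+\ell}{\ell}.$$
   Context: The ballot numbers are $b_{\ell,m}=\binom{2\ell+m}{\ell}-\binom{2\ell+m}{\ell-1}$ for integers $\ell,m\ge0$, with $\binom{n}{-1}=0$. Binomial coefficients $\binom{n}{j}$ are zero when $n<j$ (in particular when $n<0$), so only the terms with $0\le j\le \ell/2$ contribute to the sum. *)

theory Defs
  imports Complex_Main
begin

(* The case distinction encodes the convention that n choose (-1) is 0. *)
definition ballot :: "nat \<Rightarrow> nat \<Rightarrow> int" where
  "ballot l m =
     int ((2 * l + m) choose l) - (if l = 0 then 0 else int ((2 * l + m) choose (l - 1)))"

end

theory Submission
  imports Defs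
begin

text \<open>
  Substituting \<open>k = l - j\<close> turns the left-hand side into the coefficient of \<open>x ^ l\<close> in
  \<open>\<Sum>k. ballot k m * (x * (1 - x)) ^ k\<close>. Since \<open>ballot k m\<close> is the coefficient of \<open>x ^ k\<close> in
  \<open>C ^ (m + 1)\<close>, where \<open>C = 1 + x * C\<^sup>2\<close> is the Catalan series, and since
  \<open>C (x * (1 - x)) = 1 / (1 - x)\<close>, that series is \<open>(1 - x) ^ - (m + 1)\<close>, whose coefficients are
  the binomials on the right.

  The proof below extracts coefficients throughout, so that no power series appear. The
  functional equation of \<open>C\<close> becomes the recurrences \<open>ballot_Suc_Suc\<close> and
  \<open>ballot_Suc_0\<close>; multiplication by \<open>x * (1 - x)\<close> becomes the recurrence \<open>subst_coeff_Suc_Suc\<close>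
  for the transform that sends a sequence to the coefficients of its generating function after
  the substitution. Together they express each coefficient for the ballot sequence with parameter
  \<open>m + 1\<close> by the one of the same index for \<open>m\<close> and by
  coefficients of smaller index, and Pascal's rule shows that the binomials satisfy the same
  recurrence.
\<close>

text \<open>
  The coefficient of \<open>x ^ l\<close> in \<open>\<Sum>k. f k * (x * (1 - x)) ^ k\<close>: the power \<open>k = l - j\<close>
  contributes \<open>(-1) ^ j * (k choose j)\<close>.
\<close>
definition subst_coeff :: "(nat \<Rightarrow> int) \<Rightarrow> nat \<Rightarrow> int" where
  "subst_coeff f l = (\<Sum>j\<le>l. (-1) ^ j * int ((l - j) choose j) * f (l - j))"

lemma subst_coeff_add:
  "subst_coeff (\<lambda>n. f n + g n) l = subst_coeff f l + subst_coeff g l"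
  by (simp add: subst_coeff_def sum.distrib distrib_left)

text \<open>
  If \<open>F\<close> and \<open>G\<close> are the generating functions of \<open>f\<close> and of its shift, then
  \<open>F y = f 0 + y * G y\<close>; at \<open>y = x - x\<^sup>2\<close> the constant \<open>f 0\<close> does not reach the coefficients
  of index at least 2.
\<close>
lemma subst_coeff_Suc_Suc:
  "subst_coeff f (Suc (Suc l)) =
     subst_coeff (\<lambda>n. f (Suc n)) (Suc l) - subst_coeff (\<lambda>n. f (Suc n)) l"
proof -
  let ?t = "\<lambda>j. (-1) ^ j * int ((Suc l - j) choose j) * f (Suc (Suc l - j))"
  let ?u = "\<lambda>j. (-1) ^ j * int ((l - j) choose j) * f (Suc (l - j))"
  have split: "(-1) ^ Suc j * int ((Suc (Suc l) - Suc j) choose Suc j) * f (Suc (Suc l) - Suc j)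
      = ?t (Suc j) - ?u j" if "j \<le> l" for j
    using that by (simp add: Suc_diff_le algebra_simps)
  have "subst_coeff f (Suc (Suc l)) =
      f (Suc (Suc l)) + (\<Sum>j\<le>l. (-1) ^ Suc j * int ((Suc (Suc l) - Suc j) choose Suc j)
        * f (Suc (Suc l) - Suc j))"
    unfolding subst_coeff_def by (subst sum.atMost_Suc_shift) simp
  also have "\<dots> = f (Suc (Suc l)) + (\<Sum>j\<le>l. ?t (Suc j)) - (\<Sum>j\<le>l. ?u j)"
    by (simp only: sum_subtractf[symmetric] add_diff_eq[symmetric])
       (intro arg_cong2[of _ _ _ _ "(+)"] refl sum.cong split, simp)
  also have "f (Suc (Suc l)) + (\<Sum>j\<le>l. ?t (Suc j)) = (\<Sum>j\<le>Suc l. ?t j)"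
    by (subst sum.atMost_Suc_shift) simp
  finally show ?thesis
    by (simp only: subst_coeff_def)
qed

lemma ballot_0 [simp]: "ballot 0 m = 1"
  by (simp add: ballot_def)

text \<open>The identity \<open>C ^ (m + 2) = C ^ (m + 1) + x * C ^ (m + 3)\<close> for the Catalan series.\<close>
lemma ballot_Suc_Suc: "ballot (Suc l) (Suc m) = ballot (Suc l) m + ballot l (Suc (Suc m))"
  by (cases l) (simp_all add: ballot_def)

text \<open>
  The identity \<open>C = 1 + x * C\<^sup>2\<close>. Here Pascal's rule leaves two different neighbours of the
  middle of an odd row, which agree by symmetry.
\<close>
lemma ballot_Suc_0: "ballot (Suc l) 0 = ballot l (Suc 0)"
proof -
  have "Suc (2 * l) choose Suc l = Suc (2 * l) choose l"
    by (subst binomial_symmetric) simp_all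
  then show ?thesis
    by (cases l) (simp_all add: ballot_def)
qed

lemma subst_coeff_ballot: "subst_coeff (\<lambda>n. ballot n m) l = int ((m + l) choose l)"
proof (induction l arbitrary: m rule: less_induct)
  case (less l)
  consider "l = 0" | "l = 1" | k where "l = Suc (Suc k)"
    by (metis One_nat_def not0_implies_Suc)
  then show ?case
  proof cases
    case 1
    then show ?thesis by (simp add: subst_coeff_def)
  next
    case 2
    then show ?thesis by (simp add: subst_coeff_def ballot_def)
  next
    case 3
    have IH: "subst_coeff (\<lambda>n. ballot n m) (Suc k) = int ((m + Suc k) choose Suc k)"
      "subst_coeff (\<lambda>n. ballot n m) k = int ((m + k) choose k)" for m
      using less.IH 3 by simp_all
    have "subst_coeff (\<lambda>n. ballot n m) (Suc (Suc k)) = int ((m + Suc (Suc k)) choose Suc (Suc k))"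
    proof (induction m)
      case 0
      have "subst_coeff (\<lambda>n. ballot n 0) (Suc (Suc k)) =
          subst_coeff (\<lambda>n. ballot n 1) (Suc k) - subst_coeff (\<lambda>n. ballot n 1) k"
        by (simp add: subst_coeff_Suc_Suc[of "\<lambda>n. ballot n 0"] ballot_Suc_0)
      then show ?case by (simp add: IH)
    next
      case (Suc m)
      have "subst_coeff (\<lambda>n. ballot n (Suc m)) (Suc (Suc k)) =
          subst_coeff (\<lambda>n. ballot n m) (Suc (Suc k))
          + subst_coeff (\<lambda>n. ballot n (Suc (Suc m))) (Suc k)
          - subst_coeff (\<lambda>n. ballot n (Suc (Suc m))) k"
        by (simp add: subst_coeff_Suc_Suc[of "\<lambda>n. ballot n (Suc m)"]
            subst_coeff_Suc_Suc[of "\<lambda>n. ballot n m"] ballot_Suc_Suc subst_coeff_add)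
      then show ?case by (simp add: IH Suc.IH)
    qed
    with 3 show ?thesis by simp
  qed
qed

theorem mainTheorem4:
  fixes l m :: nat
  shows "(\<Sum>j\<le>l. (-1) ^ j * int ((l - j) choose j) * ballot (l - j) m) = int ((m + l) choose l)"
  using subst_coeff_ballot[of m l] by (simp only: subst_coeff_def)

end
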